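(* For every integer $n\ge 0$, the polytope $A^\vee_2\oplus (A^\vee_1)^{\oplus n}$ is a CL-polytope.
   Context: $A_d=\mathrm{conv}(\{\pm(e_i+e_{i+1}+\dots+e_j):1\le i\le j\le d\})\subset\mathbb{R}^d$; $Q^\vee=\{x:\langle x,y\rangle\ge -1\ \forall y\in Q\}$ is the polar dual. For polytopes $Q_1\subset\mathbb{R}^{d_1},Q_2\subset\mathbb{R}^{d_2}$ containing the origin, $Q_1\oplus Q_2=\mathrm{conv}((Q_1\times\{0\})\cup(\{0\}\times Q_2))\subset\mathbb{R}^{d_1+d_2}$, and $Q^{\oplus n}$ is the $n$-fold free sum of $Q$ with itself. For an integral full-dimensional polytope $Q\subset\mathbb{R}^d$, $E_Q(k)=\#(kQ\cap\mathbb{Z}^d)$ is its Ehrhart polynomial. A reflexive polytope is CL if all roots of its Ehrhart polynomial lie on the line $\mathrm{Re}(z)=-\tfrac12$ in $\mathbb{C}$. *)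

theory Defs
  imports "HOL-Analysis.Analysis" "HOL-Analysis.Finite_Function_Topology"
    "HOL-Computational_Algebra.Polynomial"
begin

text \<open>
  The dimension of the polytopes below varies with a natural number and may be 0, so \<open>\<real>\<^sup>d\<close> is
  realised inside the single real vector space \<^typ>\<open>nat \<Rightarrow>\<^sub>0 real\<close> of finitely supported
  sequences, as the subspace of those supported on the coordinates \<open>0, \<dots>, d - 1\<close>. The metric
  of \<^typ>\<open>nat \<Rightarrow>\<^sub>0 real\<close> is the \<open>\<ell>\<^sub>1\<close> metric, so it induces the usual topology on \<open>\<real>\<^sup>d\<close>.
\<close>

type_synonym vec = "nat \<Rightarrow>\<^sub>0 real"

definition Rn :: "nat \<Rightarrow> vec set" where
  "Rn d = {x. Poly_Mapping.keys x \<subseteq> {..<d}}"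

definition Zn :: "nat \<Rightarrow> vec set" where
  "Zn d = {x \<in> Rn d. \<forall>i. Poly_Mapping.lookup x i \<in> \<int>}"

definition pairing :: "nat \<Rightarrow> vec \<Rightarrow> vec \<Rightarrow> real" where
  "pairing d x y = (\<Sum>i<d. Poly_Mapping.lookup x i * Poly_Mapping.lookup y i)"

definition polar_dual :: "nat \<Rightarrow> vec set \<Rightarrow> vec set" where
  "polar_dual d Q = {x \<in> Rn d. \<forall>y\<in>Q. pairing d x y \<ge> -1}"

definition lattice_polytope :: "nat \<Rightarrow> vec set \<Rightarrow> bool" where
  "lattice_polytope d Q \<longleftrightarrow> (\<exists>V. finite V \<and> V \<subseteq> Zn d \<and> Q = convex hull V)"

text \<open>The interior is taken in \<open>\<real>\<^sup>d\<close>; in particular a reflexive polytope is full-dimensional.\<close>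

definition reflexive_polytope :: "nat \<Rightarrow> vec set \<Rightarrow> bool" where
  "reflexive_polytope d Q \<longleftrightarrow>
     lattice_polytope d Q \<and> 0 \<in> (top_of_set (Rn d)) interior_of Q \<and>
     lattice_polytope d (polar_dual d Q)"

text \<open>The standard basis is \<open>e\<^sub>0, \<dots>, e\<^sub>d\<^sub>-\<^sub>1\<close>: indices are shifted down by one.\<close>

definition root_polytope_A :: "nat \<Rightarrow> vec set" where
  "root_polytope_A d = convex hull
     (\<Union>i. \<Union>j\<in>{j. i \<le> j \<and> j < d}.
        {(\<Sum>k=i..j. Poly_Mapping.single k 1), - (\<Sum>k=i..j. Poly_Mapping.single k 1)})"

lift_definition shift :: "nat \<Rightarrow> vec \<Rightarrow> vec" is
  "\<lambda>d y i. if i < d then 0 else y (i - d)"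
proof -
  fix d :: nat and y :: "nat \<Rightarrow> real"
  assume "finite {i. y i \<noteq> 0}"
  moreover have "{i. (if i < d then 0 else y (i - d)) \<noteq> 0} \<subseteq> (\<lambda>i. i + d) ` {i. y i \<noteq> 0}"
  proof
    fix i assume "i \<in> {i. (if i < d then 0 else y (i - d)) \<noteq> 0}"
    then have "i = (i - d) + d" "y (i - d) \<noteq> 0"
      by (auto split: if_splits)
    then show "i \<in> (\<lambda>i. i + d) ` {i. y i \<noteq> 0}"
      by blast
  qed
  ultimately show "finite {i. (if i < d then 0 else y (i - d)) \<noteq> 0}"
    by (meson finite_imageI finite_subset)
qed

text \<open>
  Under \<open>\<real>\<^sup>d\<^sup>1 \<times> \<real>\<^sup>d\<^sup>2 = \<real>\<^sup>d\<^sup>1\<^sup>+\<^sup>d\<^sup>2\<close>, the set \<open>Q1 \<times> {0}\<close> is \<open>Q1\<close> itself and \<open>{0} \<times> Q2\<close> is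
  \<open>Q2\<close> shifted by \<open>d1\<close> coordinates. The argument \<open>d1\<close> is the ambient dimension of \<open>Q1\<close>.
\<close>

definition free_sum :: "nat \<Rightarrow> vec set \<Rightarrow> vec set \<Rightarrow> vec set" where
  "free_sum d1 Q1 Q2 = convex hull (Q1 \<union> shift d1 ` Q2)"

text \<open>The empty free sum is the point \<open>\<real>\<^sup>0 = {0}\<close>, the neutral element of \<open>\<oplus>\<close>.\<close>

primrec free_sum_power :: "nat \<Rightarrow> vec set \<Rightarrow> nat \<Rightarrow> vec set" where
  "free_sum_power d Q 0 = {0}"
| "free_sum_power d Q (Suc n) = free_sum d Q (free_sum_power d Q n)"

definition is_ehrhart_polynomial :: "nat \<Rightarrow> vec set \<Rightarrow> complex poly \<Rightarrow> bool" where
  "is_ehrhart_polynomial d Q p \<longleftrightarrow>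
     (\<forall>k::nat. poly p (of_nat k) = of_nat (card ((\<lambda>x. real k *\<^sub>R x) ` Q \<inter> Zn d)))"

lemma is_ehrhart_polynomial_unique:
  assumes "is_ehrhart_polynomial d Q p" "is_ehrhart_polynomial d Q q"
  shows "p = q"
proof (rule ccontr)
  assume "p \<noteq> q"
  then have "finite {z. poly (p - q) z = 0}"
    by (intro poly_roots_finite) simp
  moreover have "range (of_nat :: nat \<Rightarrow> complex) \<subseteq> {z. poly (p - q) z = 0}"
    using assms by (auto simp: is_ehrhart_polynomial_def)
  moreover have "infinite (range (of_nat :: nat \<Rightarrow> complex))"
    by (simp add: finite_image_iff)
  ultimately show False
    using finite_subset by blast
qed

definition CL_polytope :: "nat \<Rightarrow> vec set \<Rightarrow> bool" where
  "CL_polytope d Q \<longleftrightarrow> reflexive_polytope d Q \<and>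
     (\<exists>p. is_ehrhart_polynomial d Q p \<and> (\<forall>z. poly p z = 0 \<longrightarrow> Re z = - 1 / 2))"

end

theory Submission
  imports Defs
begin

text \<open>
  The dual of \<open>A\<^sub>2\<close> is the hexagon \<open>|x\<^sub>0|, |x\<^sub>1|, |x\<^sub>0 + x\<^sub>1| \<le> 1\<close>, and the free sum of polytopes
  that are unit balls of norms \<open>f\<close> and \<open>g\<close> is the unit ball of \<open>f(x) + g(y)\<close>. So the polytope is the
  unit ball of a norm with an explicit finite vertex set, its dual is a hexagon times a cube, and both
  are lattice polytopes. Slicing along the last coordinate shows that the Ehrhart series is
  \<open>(1 + 4t + t\<^sup>2)(1 + t)\<^sup>n / (1 - t)\<^sup>n\<^sup>+\<^sup>3\<close>. Since \<open>1 + 4t + t\<^sup>2 = (3(1 + t)\<^sup>2 - (1 - t)\<^sup>2) / 2\<close>, the Ehrhart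
  polynomial is \<open>(3 C\<^sub>n\<^sub>+\<^sub>2 - C\<^sub>n) / 2\<close>, where \<open>C\<^sub>m\<close> belongs to the \<open>m\<close>-dimensional cross-polytope.
  The recurrence \<open>(m + 2) C\<^sub>m\<^sub>+\<^sub>2 = w C\<^sub>m\<^sub>+\<^sub>1 + (m + 1) C\<^sub>m\<close> with \<open>w = 2z + 1\<close> shows that \<open>C\<^sub>m\<^sub>+\<^sub>1 / C\<^sub>m\<close> has
  real part of the same sign as \<open>Re w\<close> when \<open>Re w \<noteq> 0\<close>. A root satisfies
  \<open>3 w C\<^sub>n\<^sub>+\<^sub>1 = - (2n + 1) C\<^sub>n\<close>, which these signs exclude unless \<open>Re w = 0\<close>.
\<close>

subsection \<open>Ehrhart polynomials of cross-polytopes\<close>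

text \<open>Given by the three-term recurrence because the root argument rests on it; the counting
  side works with first differences instead.\<close>

fun cross_poly :: "nat \<Rightarrow> complex poly" where
  "cross_poly 0 = 1"
| "cross_poly (Suc 0) = [:1, 2:]"
| "cross_poly (Suc (Suc m)) = smult (1 / of_nat (m + 2))
     ([:1, 2:] * cross_poly (Suc m) + smult (of_nat (m + 1)) (cross_poly m))"

lemma poly_cross_poly_rec:
  "of_nat (m + 2) * poly (cross_poly (m + 2)) z =
     (2 * z + 1) * poly (cross_poly (m + 1)) z + of_nat (m + 1) * poly (cross_poly m) z"
proof -
  have "(of_nat (m + 2) :: complex) \<noteq> 0"
    by (simp only: of_nat_eq_0_iff)
  then show ?thesis
    by (simp add: algebra_simps del: of_nat_add of_nat_Suc)
qed

lemma poly_cross_poly_0: "poly (cross_poly m) 0 = 1"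
proof (induction m rule: cross_poly.induct)
  case (3 m)
  have "(of_nat (m + 2) :: complex) \<noteq> 0"
    by (simp only: of_nat_eq_0_iff)
  with 3 show ?case by (simp add: field_simps)
qed auto

text \<open>The second identity only serves to make the induction go through.\<close>

lemma poly_cross_poly_diff:
  fixes z :: complex
  defines "a \<equiv> \<lambda>m. poly (cross_poly m) (z + 1)" and "b \<equiv> \<lambda>m. poly (cross_poly m) z"
  shows "a (Suc m) - b (Suc m) = a m + b m \<and>
    (2 * z + 2) * (a m + b m) + of_nat (m + 1) * (a m - b m) =
      of_nat (m + 1) * (a (Suc m) + b (Suc m))"
proof (induction m)
  case 0
  show ?case by (simp add: a_def b_def algebra_simps)
next
  case (Suc m)
  have nz: "(of_nat (m + 2) :: complex) \<noteq> 0"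
    by (simp only: of_nat_eq_0_iff)
  have ra: "of_nat (m + 2) * a (m + 2) = (2 * z + 3) * a (m + 1) + of_nat (m + 1) * a m"
    unfolding a_def poly_cross_poly_rec by (simp add: algebra_simps)
  have rb: "of_nat (m + 2) * b (m + 2) = (2 * z + 1) * b (m + 1) + of_nat (m + 1) * b m"
    unfolding b_def poly_cross_poly_rec ..
  have D: "a (m + 1) - b (m + 1) = a m + b m"
    and S: "(2 * z + 2) * (a m + b m) + of_nat (m + 1) * (a m - b m) =
      of_nat (m + 1) * (a (m + 1) + b (m + 1))"
    using Suc by auto
  \<comment> \<open>Subtract the recurrences, writing \<open>2 * z + 3\<close> and
    \<open>2 * z + 1\<close> as \<open>2 * z + 2\<close> plus and minus 1; \<open>D\<close> and
    \<open>S\<close> then reduce everything to \<open>a (m + 1) + b (m + 1)\<close>.\<close>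
  have "of_nat (m + 2) * (a (m + 2) - b (m + 2)) =
      (2 * z + 2) * (a (m + 1) - b (m + 1)) + (a (m + 1) + b (m + 1)) + of_nat (m + 1) * (a m - b m)"
    using ra rb by (simp add: algebra_simps)
  also have "\<dots> = of_nat (m + 2) * (a (m + 1) + b (m + 1))"
    using S unfolding D by (simp add: algebra_simps)
  finally have 1: "a (m + 2) - b (m + 2) = a (m + 1) + b (m + 1)"
    using nz by (simp del: of_nat_add)
  \<comment> \<open>Adding them instead yields the second identity at the next index, with
    \<open>D\<close> read backwards.\<close>
  have "of_nat (m + 2) * (a (m + 2) + b (m + 2)) =
      (2 * z + 2) * (a (m + 1) + b (m + 1)) + (a (m + 1) - b (m + 1)) + of_nat (m + 1) * (a m + b m)"
    using ra rb by (simp add: algebra_simps)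
  also have "\<dots> = (2 * z + 2) * (a (m + 1) + b (m + 1)) + of_nat (m + 2) * (a (m + 1) - b (m + 1))"
    unfolding D[symmetric] by (simp add: algebra_simps)
  finally show ?case using 1 by simp
qed

text \<open>With \<open>w = 2 * z + 1\<close>, the ratios satisfy
  \<open>(m + 2) * r' = w + (m + 1) / r\<close>, and inversion keeps the sign of the real part.
  Multiplying by \<open>Re w\<close> treats both half-planes at once. Nonvanishing comes along
  because a ratio with nonzero real part has a nonzero numerator.\<close>

lemma Re_cross_poly_ratio:
  assumes "Re (2 * z + 1) \<noteq> 0"
  shows "poly (cross_poly m) z \<noteq> 0 \<and>
    Re (2 * z + 1) * Re (poly (cross_poly (m + 1)) z / poly (cross_poly m) z) > 0"
proof (induction m)
  case 0
  show ?case using assms by (auto simp: mult.commute zero_less_mult_iff)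
next
  case (Suc m)
  define r where "r = poly (cross_poly (m + 1)) z / poly (cross_poly m) z"
  have r: "Re (2 * z + 1) * Re r > 0" "r \<noteq> 0"
    using Suc by (auto simp: r_def)
  have C: "poly (cross_poly m) z \<noteq> 0" "poly (cross_poly (m + 1)) z \<noteq> 0"
    using Suc r by (auto simp: r_def)
  have nz: "(of_nat (m + 2) :: complex) \<noteq> 0"
    by (simp only: of_nat_eq_0_iff)
  have "of_nat (m + 2) * (poly (cross_poly (m + 2)) z / poly (cross_poly (m + 1)) z) =
      (2 * z + 1) + of_nat (m + 1) * inverse r"
    unfolding times_divide_eq_right poly_cross_poly_rec using C
    by (simp add: r_def field_simps)
  then have "Re (of_nat (m + 2) * (poly (cross_poly (m + 2)) z / poly (cross_poly (m + 1)) z)) =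
      Re (2 * z + 1) + of_nat (m + 1) * Re (inverse r)"
    by (metis Re_complex_of_real mult.commute of_real_of_nat_eq plus_complex.sel(1) scaleR_complex.sel(1) scaleR_conv_of_real)
  then have "of_nat (m + 2) * Re (poly (cross_poly (m + 2)) z / poly (cross_poly (m + 1)) z) =
      Re (2 * z + 1) + of_nat (m + 1) * Re (inverse r)"
    by (metis Re_complex_of_real mult.commute of_real_of_nat_eq scaleR_complex.sel(1) scaleR_conv_of_real)
  then have "of_nat (m + 2) * (Re (2 * z + 1) * Re (poly (cross_poly (m + 2)) z / poly (cross_poly (m + 1)) z)) =
      Re (2 * z + 1) * Re (2 * z + 1) + of_nat (m + 1) * (Re (2 * z + 1) * Re (inverse r))"
    by algebra
  moreover have "Re (2 * z + 1) * Re (inverse r) > 0"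
    using r by (simp add: zero_less_divide_iff sum_power2_gt_zero_iff complex_eq_iff)
  moreover have "Re (2 * z + 1) * Re (2 * z + 1) > 0"
    using assms by (metis not_real_square_gt_zero)
  ultimately have "of_nat (m + 2) * (Re (2 * z + 1) * Re (poly (cross_poly (m + 2)) z / poly (cross_poly (m + 1)) z)) > 0"
    by (metis add_pos_nonneg mult_nonneg_nonneg of_nat_0_le_iff less_imp_le)
  then show ?case
    using C(2) zero_less_mult_iff[of "real (m + 2)"] by simp
qed

section \<open>The Ehrhart polynomial of the free sum: roots and first differences\<close>

definition hex_cross_poly :: "nat \<Rightarrow> complex poly" where
  "hex_cross_poly n = smult (1 / 2) (smult 3 (cross_poly (n + 2)) - cross_poly n)"

lemma hex_cross_poly_roots:
  assumes "poly (hex_cross_poly n) z = 0"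
  shows "Re z = - 1 / 2"
proof (rule ccontr)
  assume "Re z \<noteq> - 1 / 2"
  then have ne: "Re (2 * z + 1) \<noteq> 0" by simp
  define r where "r = poly (cross_poly (n + 1)) z / poly (cross_poly n) z"
  have C: "poly (cross_poly n) z \<noteq> 0" and r: "Re (2 * z + 1) * Re r > 0" "r \<noteq> 0"
    using Re_cross_poly_ratio[OF ne, of n] by (auto simp: r_def)
  have "3 * poly (cross_poly (n + 2)) z = poly (cross_poly n) z"
    using assms by (simp add: hex_cross_poly_def)
  \<comment> \<open>The factor \<open>n + 2\<close> lets the recurrence eliminate
    \<open>cross_poly (n + 2)\<close>; what remains of the last term has coefficient
    \<open>3 * (n + 1) - (n + 2) = 2 * n + 1\<close>.\<close>
  then have "3 * (of_nat (n + 2) * poly (cross_poly (n + 2)) z) = of_nat (n + 2) * poly (cross_poly n) z"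
    by (metis mult.left_commute)
  then have "3 * (2 * z + 1) * poly (cross_poly (n + 1)) z + of_nat (2 * n + 1) * poly (cross_poly n) z = 0"
    unfolding poly_cross_poly_rec by (simp add: algebra_simps)
  then have "3 * (2 * z + 1) * poly (cross_poly (n + 1)) z = - of_nat (2 * n + 1) * poly (cross_poly n) z"
    by (metis add_eq_0_iff2 mult_minus_left)
  then have "3 * (2 * z + 1) * r = - of_nat (2 * n + 1)"
    using C by (simp add: r_def field_simps)
  then have "2 * z + 1 = (- (of_nat (2 * n + 1) / 3)) * inverse r"
    using r(2) by (simp add: field_simps)
  also have "\<dots> = (- (real (2 * n + 1) / 3)) *\<^sub>R inverse r"
    by (simp add: scaleR_conv_of_real)
  finally have "Re (2 * z + 1) = - (real (2 * n + 1) / 3) * Re (inverse r)"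
    by (metis scaleR_complex.sel(1))
  \<comment> \<open>The left side is a positive square; the right side is negative, since inversion
    keeps the sign of \<open>Re r\<close>.\<close>
  then have "Re (2 * z + 1) * Re (2 * z + 1) = - (real (2 * n + 1) / 3) * (Re (2 * z + 1) * Re (inverse r))"
    by (metis mult.left_commute)
  moreover have "Re (2 * z + 1) * Re (inverse r) > 0"
    using r by (simp add: zero_less_divide_iff sum_power2_gt_zero_iff complex_eq_iff)
  moreover have "Re (2 * z + 1) * Re (2 * z + 1) > 0"
    using ne by (metis not_real_square_gt_zero)
  ultimately show False
    by (smt (verit) divide_nonneg_pos mult_minus_left mult_nonneg_nonneg of_nat_0_le_iff)
qed

lemma poly_hex_cross_poly_0: "poly (hex_cross_poly n) 0 = 1"
  by (simp add: hex_cross_poly_def poly_cross_poly_0 del: cross_poly.simps)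

text \<open>At natural arguments these are the centred hexagonal numbers, matched by the count in
  \<open>lattice_ball_0\<close>.\<close>

lemma poly_hex_cross_poly_base: "poly (hex_cross_poly 0) z = 3 * z\<^sup>2 + 3 * z + 1"
  by (simp add: hex_cross_poly_def numeral_2_eq_2 field_simps power2_eq_square)

text \<open>The difference identity is linear and shifts all indices alike, so it passes to the
  combination of \<open>cross_poly (n + 2)\<close> and \<open>cross_poly n\<close>.\<close>

lemma poly_hex_cross_poly_diff:
  "poly (hex_cross_poly (Suc n)) (z + 1) =
     poly (hex_cross_poly (Suc n)) z + poly (hex_cross_poly n) (z + 1) + poly (hex_cross_poly n) z"
proof -
  let ?p = "\<lambda>m. poly (cross_poly m)"
  have "?p (n + 3) (z + 1) = ?p (n + 3) z + ?p (n + 2) (z + 1) + ?p (n + 2) z"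
    using poly_cross_poly_diff[of "n + 2" z] by (simp add: eval_nat_numeral diff_eq_eq add_ac del: cross_poly.simps)
  moreover have "?p (Suc n) (z + 1) = ?p (Suc n) z + ?p n (z + 1) + ?p n z"
    using poly_cross_poly_diff[of n z] by (simp add: diff_eq_eq add_ac del: cross_poly.simps)
  moreover have "Suc n + 2 = n + 3" by simp
  ultimately show ?thesis
    unfolding hex_cross_poly_def poly_smult poly_diff
    by (simp add: algebra_simps eval_nat_numeral del: cross_poly.simps)
qed

text \<open>Telescoping of the difference identity. The right-hand side is the shape of a slice
  count: the middle slice once, each smaller one twice.\<close>

lemma poly_hex_cross_poly_Suc:
  "poly (hex_cross_poly (Suc n)) (of_nat k) =
     poly (hex_cross_poly n) (of_nat k) + 2 * (\<Sum>i<k. poly (hex_cross_poly n) (of_nat i))"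
proof (induction k)
  case 0
  show ?case by (simp add: poly_hex_cross_poly_0)
next
  case (Suc k)
  then show ?case
    using poly_hex_cross_poly_diff[of n "of_nat k"] by (simp add: algebra_simps)
qed

subsection \<open>Free sums of unit balls\<close>

abbreviation coord :: "vec \<Rightarrow> nat \<Rightarrow> real" where
  "coord \<equiv> Poly_Mapping.lookup"

abbreviation unit_vec :: "nat \<Rightarrow> vec" where
  "unit_vec i \<equiv> Poly_Mapping.single i 1"

text \<open>This rule would rewrite \<open>unit_vec 0\<close> to the unit \<open>1\<close> of the ring of finitely supported maps.\<close>

declare single_one [simp del]

lemma coord_unit_vec: "coord (unit_vec i) j = (if i = j then 1 else 0)"
  by (simp add: lookup_single when_def)

lemma coord_scaleR: "coord (r *\<^sub>R x) i = r * coord x i"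
proof -
  have "finite {i. r * coord x i \<noteq> 0}"
    by (rule finite_subset[OF _ finite_keys[of x]]) (auto simp: in_keys_iff)
  then show ?thesis by (simp add: scaleR_poly_mapping_def)
qed

lemma coord_shift: "coord (shift d x) i = (if i < d then 0 else coord x (i - d))"
  by transfer simp

lemmas coord_simps = coord_unit_vec coord_scaleR coord_shift lookup_add lookup_minus lookup_sum

lemma Rn_iff: "x \<in> Rn d \<longleftrightarrow> (\<forall>i\<ge>d. coord x i = 0)"
  by (auto simp: Rn_def in_keys_iff subset_iff not_less)
     (metis not_le)

lemma Zn_iff: "x \<in> Zn d \<longleftrightarrow> (\<forall>i\<ge>d. coord x i = 0) \<and> (\<forall>i. coord x i \<in> \<int>)"
  by (simp add: Zn_def Rn_iff)

lemma Rn_eqI: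
  assumes "x \<in> Rn d" "y \<in> Rn d" "\<And>i. i < d \<Longrightarrow> coord x i = coord y i"
  shows "x = y"
  using assms by (intro poly_mapping_eqI) (metis Rn_iff not_le)

definition vec_of :: "nat \<Rightarrow> (nat \<Rightarrow> real) \<Rightarrow> vec" where
  "vec_of d f = (\<Sum>i<d. f i *\<^sub>R unit_vec i)"

lemma coord_vec_of: "coord (vec_of d f) i = (if i < d then f i else 0)"
  by (simp add: vec_of_def coord_simps if_distrib cong: if_cong)

lemma subspace_Rn: "subspace (Rn d)"
  by (simp add: subspace_def Rn_iff coord_simps)

lemma linear_shift: "linear (shift d)"
  by (auto intro!: linearI poly_mapping_eqI simp: coord_simps)

lemma shift_unit_vec: "shift d (unit_vec i) = unit_vec (d + i)"
  by (rule poly_mapping_eqI) (auto simp: coord_simps)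

lemma shift_0: "shift d 0 = 0"
  by (rule linear_0[OF linear_shift])

lemma shift_neg: "shift d (- x) = - shift d x"
  by (rule linear_neg[OF linear_shift])

lemma free_sum_convex_hull:
  "free_sum d (convex hull V) (convex hull W) = convex hull (V \<union> shift d ` W)"
  by (metis free_sum_def convex_hull_linear_image hull_Un_left hull_Un_right linear_shift)

text \<open>For fixed \<open>x\<close> the constraint is a half-space in \<open>y\<close>, hence
  convex, so it passes from the generators to their hull.\<close>

lemma polar_dual_convex_hull:
  "polar_dual d (convex hull V) = {x \<in> Rn d. \<forall>v\<in>V. pairing d x v \<ge> -1}"
proof -
  have "pairing d x y \<ge> -1" if V: "\<forall>v\<in>V. pairing d x v \<ge> -1" and y: "y \<in> convex hull V" for x y
  proof -
    have "linear (pairing d x)"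
      by (intro linearI) (simp_all add: pairing_def coord_simps distrib_left sum.distrib sum_distrib_left algebra_simps)
    then have "convex (pairing d x -` {-1..})"
      by (intro convex_linear_vimage) auto
    moreover have "V \<subseteq> pairing d x -` {-1..}"
      using V by auto
    ultimately show ?thesis
      using hull_minimal[of V "pairing d x -` {-1..}" convex] y by auto
  qed
  then show ?thesis
    by (auto simp: polar_dual_def intro: hull_inc)
qed

lemma pairing_unit_vec: "i < d \<Longrightarrow> pairing d x (unit_vec i) = coord x i"
  by (simp add: pairing_def coord_simps if_distrib cong: if_cong)

lemma pairing_neg: "pairing d x (- y) = - pairing d x y"
  by (simp add: pairing_def sum_negf)

lemma pairing_add: "pairing d x (y + z) = pairing d x y + pairing d x z"
  by (simp add: pairing_def coord_simps sum.distrib distrib_left)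

lemma pairing_diff: "pairing d x (y - z) = pairing d x y - pairing d x z"
  by (simp add: pairing_def coord_simps sum_subtractf right_diff_distrib)

text \<open>The functions in question read only finitely many coordinates, so they are seminorms on
  the whole type and definite only on \<open>Rn d\<close>.\<close>

definition norm_on :: "nat \<Rightarrow> (vec \<Rightarrow> real) \<Rightarrow> bool" where
  "norm_on d f \<longleftrightarrow> (\<forall>x y. f (x + y) \<le> f x + f y) \<and> (\<forall>c x. f (c *\<^sub>R x) = \<bar>c\<bar> * f x) \<and>
     (\<forall>x\<in>Rn d. f x = 0 \<longrightarrow> x = 0)"

lemma
  assumes "norm_on d f"
  shows norm_on_add: "f (x + y) \<le> f x + f y"
    and norm_on_scaleR: "f (c *\<^sub>R x) = \<bar>c\<bar> * f x"
    and norm_on_eq_0: "x \<in> Rn d \<Longrightarrow> f x = 0 \<Longrightarrow> x = 0"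
  using assms by (auto simp: norm_on_def)

lemma norm_on_0: "norm_on d f \<Longrightarrow> f 0 = 0"
  using norm_on_scaleR[of d f 0 0] by simp

lemma norm_on_nonneg:
  assumes "norm_on d f" shows "f x \<ge> 0"
  using norm_on_add[OF assms, of x "-1 *\<^sub>R x"] norm_on_scaleR[OF assms, of "-1" x] norm_on_0[OF assms]
  by simp

text \<open>When \<open>f x = 0\<close>, the normalisation \<open>inverse (f x) *\<^sub>R x\<close> is 0, and so is \<open>x\<close>.\<close>

lemma norm_on_normalise:
  assumes f: "norm_on d f" and x: "x \<in> Rn d"
  obtains u where "u \<in> Rn d" "f u \<le> 1" "x = f x *\<^sub>R u"
proof
  show "inverse (f x) *\<^sub>R x \<in> Rn d"
    using x by (simp add: subspace_Rn subspace_scale)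
  show "f (inverse (f x) *\<^sub>R x) \<le> 1"
    using norm_on_nonneg[OF f, of x] by (cases "f x = 0") (simp_all add: norm_on_scaleR[OF f] norm_on_0[OF f])
  show "x = f x *\<^sub>R inverse (f x) *\<^sub>R x"
    using norm_on_eq_0[OF f x] by (cases "f x = 0") auto
qed

text \<open>The missing weight \<open>1 - a - b\<close> goes to the origin.\<close>

lemma convex_with_0_combination:
  fixes H :: "'a :: real_vector set"
  assumes "convex H" "0 \<in> H" "u \<in> H" "v \<in> H" "0 \<le> a" "0 \<le> b" "a + b \<le> 1"
  shows "a *\<^sub>R u + b *\<^sub>R v \<in> H"
  using convex_sum[of "{0, 1, 2 :: nat}" H
      "\<lambda>i. if i = 0 then a else if i = 1 then b else 1 - a - b"
      "\<lambda>i. if i = 0 then u else if i = 1 then v else 0"] assms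
  by simp

text \<open>The right-hand side is convex and contains both balls. Conversely, normalising both
  parts writes the point as \<open>f x *\<^sub>R u + g y *\<^sub>R shift d v\<close> with
  \<open>u\<close> and \<open>v\<close> in the balls and weights of sum at most 1.\<close>

lemma free_sum_norm_balls:
  assumes f: "norm_on d f" and g: "norm_on d' g"
  shows "free_sum d {x \<in> Rn d. f x \<le> 1} {y \<in> Rn d'. g y \<le> 1} =
    {x + shift d y | x y. x \<in> Rn d \<and> y \<in> Rn d' \<and> f x + g y \<le> 1}" (is "_ = ?R")
proof
  have 0: "(0 :: vec) \<in> Rn k" for k by (simp add: Rn_iff)
  show "free_sum d {x \<in> Rn d. f x \<le> 1} {y \<in> Rn d'. g y \<le> 1} \<subseteq> ?R"
    unfolding free_sum_def
  proof (rule hull_minimal)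
    show "{x \<in> Rn d. f x \<le> 1} \<union> shift d ` {y \<in> Rn d'. g y \<le> 1} \<subseteq> ?R"
    proof safe
      fix x assume "x \<in> Rn d" "f x \<le> 1"
      then show "\<exists>x' y. x = x' + shift d y \<and> x' \<in> Rn d \<and> y \<in> Rn d' \<and> f x' + g y \<le> 1"
        using 0 norm_on_0[OF g] shift_0 by (intro exI[of _ x] exI[of _ 0]) auto
    next
      fix y assume "y \<in> Rn d'" "g y \<le> 1"
      then show "\<exists>x y'. shift d y = x + shift d y' \<and> x \<in> Rn d \<and> y' \<in> Rn d' \<and> f x + g y' \<le> 1"
        using 0 norm_on_0[OF f] by (intro exI[of _ 0] exI[of _ y]) auto
    qed
    show "convex ?R"
    proof (rule convexI)
      fix p q :: vec and u v :: real
      assume "p \<in> ?R" "q \<in> ?R" and uv: "0 \<le> u" "0 \<le> v" "u + v = 1"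
      then obtain x y x' y' where p: "p = x + shift d y" "x \<in> Rn d" "y \<in> Rn d'" "f x + g y \<le> 1"
        and q: "q = x' + shift d y'" "x' \<in> Rn d" "y' \<in> Rn d'" "f x' + g y' \<le> 1"
        by blast
      have "u *\<^sub>R p + v *\<^sub>R q = (u *\<^sub>R x + v *\<^sub>R x') + shift d (u *\<^sub>R y + v *\<^sub>R y')"
        by (simp add: p q linear_add[OF linear_shift] linear_scale[OF linear_shift] algebra_simps)
      moreover have "u *\<^sub>R x + v *\<^sub>R x' \<in> Rn d" "u *\<^sub>R y + v *\<^sub>R y' \<in> Rn d'"
        using p q by (simp_all add: subspace_Rn subspace_add subspace_scale)
      moreover have "f (u *\<^sub>R x + v *\<^sub>R x') + g (u *\<^sub>R y + v *\<^sub>R y') \<le> 1"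
      proof -
        have "f (u *\<^sub>R x + v *\<^sub>R x') \<le> u * f x + v * f x'"
          using norm_on_add[OF f, of "u *\<^sub>R x" "v *\<^sub>R x'"] uv by (simp add: norm_on_scaleR[OF f])
        moreover have "g (u *\<^sub>R y + v *\<^sub>R y') \<le> u * g y + v * g y'"
          using norm_on_add[OF g, of "u *\<^sub>R y" "v *\<^sub>R y'"] uv by (simp add: norm_on_scaleR[OF g])
        moreover have "u * (f x + g y) + v * (f x' + g y') \<le> 1"
          using convex_bound_le[OF p(4) q(4) uv] .
        ultimately show ?thesis by (simp add: algebra_simps)
      qed
      ultimately show "u *\<^sub>R p + v *\<^sub>R q \<in> ?R" by blast
    qed
  qed
  show "?R \<subseteq> free_sum d {x \<in> Rn d. f x \<le> 1} {y \<in> Rn d'. g y \<le> 1}"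
  proof
    fix z assume "z \<in> ?R"
    then obtain x y where z: "z = x + shift d y" "x \<in> Rn d" "y \<in> Rn d'" "f x + g y \<le> 1"
      by blast
    obtain u where u: "u \<in> Rn d" "f u \<le> 1" "x = f x *\<^sub>R u"
      using norm_on_normalise[OF f z(2)] .
    obtain v where v: "v \<in> Rn d'" "g v \<le> 1" "y = g y *\<^sub>R v"
      using norm_on_normalise[OF g z(3)] .
    define H where "H = free_sum d {x \<in> Rn d. f x \<le> 1} {y \<in> Rn d'. g y \<le> 1}"
    have "convex H" "u \<in> H" "shift d v \<in> H" "0 \<in> H"
      using u v norm_on_0[OF f] 0 by (auto simp: H_def free_sum_def intro!: hull_inc)
    then have "f x *\<^sub>R u + g y *\<^sub>R shift d v \<in> H"
      using z norm_on_nonneg[OF f, of x] norm_on_nonneg[OF g, of y]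
      by (intro convex_with_0_combination)
    then show "z \<in> free_sum d {x \<in> Rn d. f x \<le> 1} {y \<in> Rn d'. g y \<le> 1}"
      using u v z by (metis H_def linear_scale[OF linear_shift])
  qed
qed

lemma convex_norm_ball:
  assumes "norm_on d f"
  shows "convex {x \<in> Rn d. f x \<le> 1}"
proof -
  have "f (u *\<^sub>R x + v *\<^sub>R y) \<le> 1" if "f x \<le> 1" "f y \<le> 1" "0 \<le> u" "0 \<le> v" "u + v = 1" for x y u v
    using norm_on_add[OF assms, of "u *\<^sub>R x" "v *\<^sub>R y"] convex_bound_le[OF that] that(3,4)
    by (simp add: norm_on_scaleR[OF assms])
  then show ?thesis
    by (auto simp: convex_def subspace_Rn subspace_add subspace_scale)
qed

lemma Rn_sum_decomp:
  assumes "z \<in> Rn (d + d')"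
  obtains x y where "x \<in> Rn d" "y \<in> Rn d'" "z = x + shift d y"
proof
  show "vec_of d (coord z) \<in> Rn d" "vec_of d' (\<lambda>i. coord z (d + i)) \<in> Rn d'"
    by (simp_all add: Rn_iff coord_vec_of)
  show "z = vec_of d (coord z) + shift d (vec_of d' (\<lambda>i. coord z (d + i)))"
    using assms by (intro poly_mapping_eqI) (auto simp: coord_simps coord_vec_of Rn_iff)
qed

lemma Rn_sum: "x \<in> Rn d \<Longrightarrow> y \<in> Rn d' \<Longrightarrow> x + shift d y \<in> Rn (d + d')"
  by (simp add: Rn_iff coord_simps)

subsection \<open>Hexagons and cross-polytopes\<close>

text \<open>The sign \<open>s\<close> serves two mirror-image hexagons: \<open>s = 1\<close> is the
  dual of \<open>root_polytope_A 2\<close>, and \<open>s = -1\<close> occurs in the dual of the free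
  sum.\<close>

definition hex_norm :: "real \<Rightarrow> vec \<Rightarrow> real" where
  "hex_norm s x = max \<bar>coord x 0\<bar> (max \<bar>coord x 1\<bar> \<bar>coord x 0 + s * coord x 1\<bar>)"

text \<open>For \<open>s = 1\<close> and \<open>s = -1\<close>, the six vertices together with the
  origin, which takes up slack weight in convex combinations.\<close>

definition hex_verts :: "real \<Rightarrow> vec set" where
  "hex_verts s = (let e = unit_vec 0; f = unit_vec 1
     in {0, e, - e, f, - f, e - s *\<^sub>R f, - (e - s *\<^sub>R f)})"

lemma hex_norm_le_iff:
  "hex_norm s x \<le> r \<longleftrightarrow>
     \<bar>coord x 0\<bar> \<le> r \<and> \<bar>coord x 1\<bar> \<le> r \<and> \<bar>coord x 0 + s * coord x 1\<bar> \<le> r"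
  by (auto simp: hex_norm_def)

lemma norm_on_hex_norm: "norm_on 2 (hex_norm s)"
  unfolding norm_on_def
proof (intro conjI allI ballI impI)
  fix x y
  have "coord (x + y) 0 + s * coord (x + y) 1 = (coord x 0 + s * coord x 1) + (coord y 0 + s * coord y 1)"
    by (simp add: coord_simps algebra_simps)
  moreover have "coord (x + y) i = coord x i + coord y i" for i
    by (rule lookup_add)
  ultimately show "hex_norm s (x + y) \<le> hex_norm s x + hex_norm s y"
    using hex_norm_le_iff[of s x "hex_norm s x", THEN iffD1, OF order_refl]
      hex_norm_le_iff[of s y "hex_norm s y", THEN iffD1, OF order_refl]
    by (simp only: hex_norm_le_iff) (blast intro: order_trans[OF abs_triangle_ineq add_mono])
next
  fix c x
  have "coord (c *\<^sub>R x) 0 + s * coord (c *\<^sub>R x) 1 = c * (coord x 0 + s * coord x 1)"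
    by (simp add: coord_simps algebra_simps)
  then show "hex_norm s (c *\<^sub>R x) = \<bar>c\<bar> * hex_norm s x"
    unfolding hex_norm_def by (simp add: coord_scaleR abs_mult max_mult_distrib_left)
next
  fix x assume "x \<in> Rn 2" "hex_norm s x = 0"
  then have "coord x 0 = 0" "coord x 1 = 0"
    using hex_norm_le_iff[of s x 0] by auto
  with \<open>x \<in> Rn 2\<close> show "x = 0"
    by (intro Rn_eqI[of _ 2]) (auto simp: Rn_iff less_2_cases_iff)
qed

text \<open>The hexagon splits into six triangles with apex 0 over consecutive vertices. In each of
  them the two weights are nonnegative and add up to the absolute value of \<open>a\<close>,
  \<open>c\<close> or \<open>a + c\<close>.\<close>

lemma hexagon_eq_hull:
  assumes s: "s = 1 \<or> s = -1"
  shows "{x \<in> Rn 2. hex_norm s x \<le> 1} = convex hull (hex_verts s)"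
proof
  show "convex hull (hex_verts s) \<subseteq> {x \<in> Rn 2. hex_norm s x \<le> 1}"
    using s by (intro hull_minimal convex_norm_ball norm_on_hex_norm)
      (auto simp: hex_verts_def Let_def Rn_iff hex_norm_le_iff coord_simps)
next
  define H where "H = convex hull (hex_verts s)"
  have comb: "a *\<^sub>R u + b *\<^sub>R v \<in> H"
    if "u \<in> hex_verts s" "v \<in> hex_verts s" "0 \<le> a" "0 \<le> b" "a + b \<le> 1" for a b u v
    using that unfolding H_def
    by (intro convex_with_0_combination) (auto simp: hex_verts_def Let_def intro!: hull_inc)
  define e where "e = unit_vec 0"
  \<comment> \<open>Absorbing the sign into \<open>f\<close> and \<open>c\<close> treats both
    hexagons alike, since \<open>s * s = 1\<close>.\<close>
  define f where "f = s *\<^sub>R unit_vec 1"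
  have V: "e \<in> hex_verts s" "- e \<in> hex_verts s" "f \<in> hex_verts s" "- f \<in> hex_verts s"
      "e - f \<in> hex_verts s" "f - e \<in> hex_verts s"
    using s by (auto simp: hex_verts_def Let_def e_def f_def)
  show "{x \<in> Rn 2. hex_norm s x \<le> 1} \<subseteq> convex hull (hex_verts s)"
  proof safe
    fix x assume x: "x \<in> Rn 2" "hex_norm s x \<le> 1"
    define a c where "a = coord x 0" and "c = s * coord x 1"
    have ac: "\<bar>a\<bar> \<le> 1" "\<bar>c\<bar> \<le> 1" "\<bar>a + c\<bar> \<le> 1"
      using x s by (auto simp: hex_norm_le_iff a_def c_def)
    have x_eq: "x = a *\<^sub>R e + c *\<^sub>R f"
      using x s by (intro Rn_eqI[of _ 2])
        (auto simp: Rn_iff coord_simps less_2_cases_iff a_def c_def e_def f_def)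
    consider "a \<ge> 0" "c \<ge> 0" | "a \<le> 0" "c \<le> 0"
      | "a \<ge> 0" "c \<le> 0" "a + c \<ge> 0" | "a \<ge> 0" "c \<le> 0" "a + c \<le> 0"
      | "a \<le> 0" "c \<ge> 0" "a + c \<ge> 0" | "a \<le> 0" "c \<ge> 0" "a + c \<le> 0"
      by linarith
    then have "x \<in> H"
    proof cases
      case 1
      then show ?thesis using comb[OF V(1) V(3), of a c] ac by (simp add: x_eq)
    next
      case 2
      then show ?thesis using comb[OF V(2) V(4), of "- a" "- c"] ac by (simp add: x_eq)
    next
      case 3
      then show ?thesis using comb[OF V(1) V(5), of "a + c" "- c"] ac
        by (simp add: x_eq algebra_simps)
    next
      case 4
      then show ?thesis using comb[OF V(5) V(4), of a "- (a + c)"] ac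
        by (simp add: x_eq algebra_simps)
    next
      case 5
      then show ?thesis using comb[OF V(6) V(3), of "- a" "a + c"] ac
        by (simp add: x_eq algebra_simps)
    next
      case 6
      then show ?thesis using comb[OF V(6) V(2), of c "- (a + c)"] ac
        by (simp add: x_eq algebra_simps)
    qed
    then show "x \<in> convex hull (hex_verts s)" by (simp add: H_def)
  qed
qed

section \<open>Cross-polytopes and the duals of the two root polytopes\<close>

definition cross_norm :: "nat \<Rightarrow> vec \<Rightarrow> real" where
  "cross_norm n x = (\<Sum>i<n. \<bar>coord x i\<bar>)"

text \<open>Including the origin makes the hull for \<open>n = 0\<close> equal to
  \<open>{0}\<close>, the empty free sum.\<close>

definition cross_verts :: "nat \<Rightarrow> vec set" where
  "cross_verts n = insert 0 (\<Union>i<n. {unit_vec i, - unit_vec i})"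

lemma norm_on_cross_norm: "norm_on n (cross_norm n)"
  unfolding norm_on_def
proof (intro conjI allI ballI impI)
  fix x y
  show "cross_norm n (x + y) \<le> cross_norm n x + cross_norm n y"
    by (simp add: cross_norm_def lookup_add sum.distrib[symmetric] sum_mono)
next
  fix c x
  show "cross_norm n (c *\<^sub>R x) = \<bar>c\<bar> * cross_norm n x"
    by (simp add: cross_norm_def coord_scaleR abs_mult sum_distrib_left)
next
  fix x assume "x \<in> Rn n" "cross_norm n x = 0"
  then show "x = 0"
    by (intro Rn_eqI[of _ n]) (auto simp: Rn_iff cross_norm_def sum_nonneg_eq_0_iff)
qed

lemma cross_norm_sum:
  assumes "x \<in> Rn d"
  shows "cross_norm (d + n) (x + shift d y) = cross_norm d x + cross_norm n y"
proof -
  have "cross_norm (d + n) (x + shift d y) =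
      (\<Sum>i<d. \<bar>coord (x + shift d y) i\<bar>) + (\<Sum>i<n. \<bar>coord (x + shift d y) (d + i)\<bar>)"
    unfolding cross_norm_def by (induction n) simp_all
  then show ?thesis
    using assms by (simp add: cross_norm_def coord_simps Rn_iff)
qed

lemma root_polytope_A_1: "root_polytope_A 1 = convex hull {unit_vec 0, - unit_vec 0}"
proof -
  have "(\<Union>i. \<Union>j\<in>{j. i \<le> j \<and> j < 1}. F i j) = F 0 0" for F :: "nat \<Rightarrow> nat \<Rightarrow> vec set"
    by auto
  then show ?thesis by (simp add: root_polytope_A_def)
qed

lemma root_polytope_A_2:
  "root_polytope_A 2 = convex hull {unit_vec 0, - unit_vec 0, unit_vec 1, - unit_vec 1,
     unit_vec 0 + unit_vec 1, - (unit_vec 0 + unit_vec 1)}"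
proof -
  have "(\<Union>i. \<Union>j\<in>{j. i \<le> j \<and> j < 2}. F i j) = F 0 0 \<union> F 1 1 \<union> F 0 1"
    for F :: "nat \<Rightarrow> nat \<Rightarrow> vec set"
    by (auto simp: less_2_cases_iff le_Suc_eq)
  moreover have "{0..Suc 0} = {0, 1}" by auto
  ultimately show ?thesis by (simp add: root_polytope_A_def insert_commute)
qed

lemma polar_dual_A_1: "polar_dual 1 (root_polytope_A 1) = {x \<in> Rn 1. cross_norm 1 x \<le> 1}"
  unfolding root_polytope_A_1 polar_dual_convex_hull
  by (auto simp: pairing_neg pairing_unit_vec cross_norm_def)

lemma polar_dual_A_2: "polar_dual 2 (root_polytope_A 2) = {x \<in> Rn 2. hex_norm 1 x \<le> 1}"
  unfolding root_polytope_A_2 polar_dual_convex_hull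
  by (auto simp: pairing_neg pairing_add pairing_diff pairing_unit_vec hex_norm_le_iff)

lemma segment_eq_hull: "{x \<in> Rn 1. cross_norm 1 x \<le> 1} = convex hull (cross_verts 1)"
proof
  show "convex hull (cross_verts 1) \<subseteq> {x \<in> Rn 1. cross_norm 1 x \<le> 1}"
    by (intro hull_minimal convex_norm_ball norm_on_cross_norm)
      (auto simp: cross_verts_def Rn_iff cross_norm_def coord_simps)
  show "{x \<in> Rn 1. cross_norm 1 x \<le> 1} \<subseteq> convex hull (cross_verts 1)"
  proof safe
    fix x assume x: "x \<in> Rn 1" "cross_norm 1 x \<le> 1"
    define a where "a = coord x 0"
    \<comment> \<open>Positive and negative part of \<open>a\<close>; the two weights add up to its
      absolute value.\<close>
    have "x = max a 0 *\<^sub>R unit_vec 0 + max (- a) 0 *\<^sub>R (- unit_vec 0)"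
      using x by (intro Rn_eqI[of _ 1]) (auto simp: Rn_iff coord_simps a_def)
    also have "\<dots> \<in> convex hull (cross_verts 1)"
      using x by (intro convex_with_0_combination)
        (auto simp: cross_verts_def cross_norm_def a_def intro!: hull_inc)
    finally show "x \<in> convex hull (cross_verts 1)" .
  qed
qed

lemma shift_cross_verts:
  "shift d ` cross_verts n = insert 0 (\<Union>i<n. {unit_vec (d + i), - unit_vec (d + i)})"
  by (auto simp: cross_verts_def image_UN shift_0 shift_neg shift_unit_vec)

lemma cross_verts_Suc: "cross_verts 1 \<union> shift 1 ` cross_verts n = cross_verts (Suc n)"
  unfolding shift_cross_verts by (auto simp: cross_verts_def lessThan_Suc_eq_insert_0)

text \<open>The description by generators serves integrality and duality; the description as a ball,
  proved next, serves counting.\<close>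

lemma cross_polytope_eq_hull:
  "free_sum_power 1 (polar_dual 1 (root_polytope_A 1)) n = convex hull (cross_verts n)"
proof (induction n)
  case 0
  show ?case by (simp add: cross_verts_def)
next
  case (Suc n)
  then show ?case
    unfolding polar_dual_A_1 segment_eq_hull
    by (simp add: free_sum_convex_hull cross_verts_Suc del: One_nat_def)
qed

lemma cross_polytope_eq_ball:
  "free_sum_power 1 (polar_dual 1 (root_polytope_A 1)) n = {x \<in> Rn n. cross_norm n x \<le> 1}"
proof (induction n)
  case 0
  have "x = 0" if "x \<in> Rn 0" for x
    using that by (intro Rn_eqI[of _ 0]) (auto simp: Rn_iff)
  then show ?case by (auto simp: Rn_iff cross_norm_def)
next
  case (Suc n)
  have "free_sum_power 1 (polar_dual 1 (root_polytope_A 1)) (Suc n) =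
      {x + shift 1 y | x y. x \<in> Rn 1 \<and> y \<in> Rn n \<and> cross_norm 1 x + cross_norm n y \<le> 1}"
    unfolding free_sum_power.simps Suc unfolding polar_dual_A_1
    by (intro free_sum_norm_balls norm_on_cross_norm)
  also have "\<dots> = {x \<in> Rn (1 + n). cross_norm (1 + n) x \<le> 1}"
    \<comment> \<open>Splitting off the first coordinate identifies the sums with vectors in
      dimension \<open>1 + n\<close>.\<close>
    by (auto simp: cross_norm_sum Rn_sum simp del: One_nat_def plus_1_eq_Suc elim!: Rn_sum_decomp)
       (metis cross_norm_sum)
  finally show ?case by simp
qed

section \<open>The free sum of hexagon and cross-polytope as a unit ball\<close>

definition hex_cross_norm :: "nat \<Rightarrow> vec \<Rightarrow> real" where
  "hex_cross_norm n x = hex_norm 1 x + (\<Sum>i<n. \<bar>coord x (2 + i)\<bar>)"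

definition hex_cross_polytope :: "nat \<Rightarrow> vec set" where
  "hex_cross_polytope n = {x \<in> Rn (2 + n). hex_cross_norm n x \<le> 1}"

lemma norm_on_hex_cross_norm: "norm_on (2 + n) (hex_cross_norm n)"
  unfolding norm_on_def
proof (intro conjI allI ballI impI)
  fix x y
  have "(\<Sum>i<n. \<bar>coord (x + y) (2 + i)\<bar>) \<le> (\<Sum>i<n. \<bar>coord x (2 + i)\<bar>) + (\<Sum>i<n. \<bar>coord y (2 + i)\<bar>)"
    by (simp add: lookup_add sum.distrib[symmetric] sum_mono)
  then show "hex_cross_norm n (x + y) \<le> hex_cross_norm n x + hex_cross_norm n y"
    using norm_on_add[OF norm_on_hex_norm, of 1 x y] by (simp add: hex_cross_norm_def)
next
  fix c x
  show "hex_cross_norm n (c *\<^sub>R x) = \<bar>c\<bar> * hex_cross_norm n x"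
    by (simp add: hex_cross_norm_def norm_on_scaleR[OF norm_on_hex_norm] coord_scaleR abs_mult
        sum_distrib_left distrib_left)
next
  fix x assume x: "x \<in> Rn (2 + n)" "hex_cross_norm n x = 0"
  have "(\<Sum>i<n. \<bar>coord x (2 + i)\<bar>) \<ge> 0" by (simp add: sum_nonneg)
  with x norm_on_nonneg[OF norm_on_hex_norm, of 1 x]
  have 1: "hex_norm 1 x = 0" and 2: "(\<Sum>i<n. \<bar>coord x (2 + i)\<bar>) = 0"
    unfolding hex_cross_norm_def by linarith+
  from 1 have x01: "coord x 0 = 0" "coord x 1 = 0"
    using hex_norm_le_iff[of 1 x 0] by auto
  have x2: "coord x (2 + i) = 0" if "i < n" for i
    using 2 that by (simp add: sum_nonneg_eq_0_iff)
  have "coord x i = 0" if "i < 2 + n" for i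
  proof (cases "i < 2")
    case True
    with x01 show ?thesis by (auto simp: less_2_cases_iff)
  next
    case False
    then obtain j where "i = 2 + j" by (metis le_Suc_ex not_less)
    with that x2[of j] show ?thesis by simp
  qed
  with x show "x = 0"
    by (intro Rn_eqI[of _ "2 + n"]) (auto simp: Rn_iff)
qed

lemma hex_cross_norm_sum:
  assumes "x \<in> Rn 2"
  shows "hex_cross_norm n (x + shift 2 y) = hex_norm 1 x + cross_norm n y"
  using assms by (simp add: hex_cross_norm_def hex_norm_def cross_norm_def coord_simps Rn_iff)

lemma hex_cross_polytope_eq_free_sum:
  "hex_cross_polytope n = free_sum 2 (polar_dual 2 (root_polytope_A 2))
     (free_sum_power 1 (polar_dual 1 (root_polytope_A 1)) n)"
proof -
  have "free_sum 2 (polar_dual 2 (root_polytope_A 2))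
      (free_sum_power 1 (polar_dual 1 (root_polytope_A 1)) n) =
      {x + shift 2 y | x y. x \<in> Rn 2 \<and> y \<in> Rn n \<and> hex_norm 1 x + cross_norm n y \<le> 1}"
    unfolding cross_polytope_eq_ball polar_dual_A_2
    by (intro free_sum_norm_balls norm_on_cross_norm norm_on_hex_norm)
  also have "\<dots> = hex_cross_polytope n"
    by (auto simp: hex_cross_polytope_def hex_cross_norm_sum Rn_sum
        simp del: add_2_eq_Suc add_2_eq_Suc' elim!: Rn_sum_decomp)
       (metis hex_cross_norm_sum)
  finally show ?thesis ..
qed

lemma hex_cross_polytope_eq_hull:
  "hex_cross_polytope n = convex hull (hex_verts 1 \<union> shift 2 ` cross_verts n)"
  unfolding hex_cross_polytope_eq_free_sum cross_polytope_eq_hull polar_dual_A_2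
  by (simp add: hexagon_eq_hull free_sum_convex_hull)

text \<open>Moving along a later axis is invisible to the hexagon; this is what permits slicing by
  the last coordinate.\<close>

lemma hex_norm_add_unit_vec: "hex_norm s (x + t *\<^sub>R unit_vec (2 + n)) = hex_norm s x"
  by (simp add: hex_norm_def coord_simps)

subsection \<open>Reflexivity\<close>

text \<open>A prism is the Minkowski sum of its base and a lattice segment, and the hull of a sum of
  sets is the sum of the hulls.\<close>

lemma lattice_polytope_prism:
  assumes "lattice_polytope d Q"
  shows "lattice_polytope (Suc d) {x + t *\<^sub>R unit_vec d | x t. x \<in> Q \<and> \<bar>t\<bar> \<le> 1}"
proof -
  obtain V where V: "finite V" "V \<subseteq> Zn d" "Q = convex hull V"
    using assms by (auto simp: lattice_polytope_def)
  let ?e = "unit_vec d"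
  have "{t *\<^sub>R ?e | t. \<bar>t\<bar> \<le> 1} = closed_segment (- ?e) ?e"
  proof safe
    fix t :: real assume "\<bar>t\<bar> \<le> 1"
    then show "t *\<^sub>R ?e \<in> closed_segment (- ?e) ?e"
      unfolding in_segment
      \<comment> \<open>Inverse of the parametrisation \<open>t = 2 * u - 1\<close> of the
        segment.\<close>
      by (intro exI[of _ "(t + 1) / 2"])
        (auto intro!: poly_mapping_eqI simp: coord_simps field_simps)
  next
    fix x assume "x \<in> closed_segment (- ?e) ?e"
    then obtain u where "0 \<le> u" "u \<le> 1" "x = (1 - u) *\<^sub>R - ?e + u *\<^sub>R ?e"
      by (auto simp: in_segment)
    moreover have "(1 - u) *\<^sub>R - ?e + u *\<^sub>R ?e = (2 * u - 1) *\<^sub>R ?e"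
      by (intro poly_mapping_eqI) (simp add: coord_simps)
    ultimately show "\<exists>t. x = t *\<^sub>R ?e \<and> \<bar>t\<bar> \<le> 1"
      by (intro exI[of _ "2 * u - 1"]) auto
  qed
  then have seg: "{t *\<^sub>R ?e | t. \<bar>t\<bar> \<le> 1} = convex hull {- ?e, ?e}"
    by (simp add: segment_convex_hull)
  have "{x + t *\<^sub>R ?e | x t. x \<in> Q \<and> \<bar>t\<bar> \<le> 1} = Q + {t *\<^sub>R ?e | t. \<bar>t\<bar> \<le> 1}"
    by (auto simp: set_plus_def)
  also have "\<dots> = convex hull (V + {- ?e, ?e})"
    unfolding seg V(3) by (rule convex_hull_set_plus[symmetric])
  finally have "{x + t *\<^sub>R ?e | x t. x \<in> Q \<and> \<bar>t\<bar> \<le> 1} = convex hull (V + {- ?e, ?e})" .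
  moreover have "V + {- ?e, ?e} \<subseteq> Zn (Suc d)"
    using V(2) by (auto simp: set_plus_def Zn_iff coord_simps subset_iff)
  moreover have "finite (V + {- ?e, ?e})"
    using V(1) by (simp add: finite_set_plus)
  ultimately show ?thesis
    unfolding lattice_polytope_def by blast
qed

lemma hex_verts_Zn: "s = 1 \<or> s = -1 \<Longrightarrow> hex_verts s \<subseteq> Zn (2 + n)"
  by (auto simp: hex_verts_def Let_def Zn_iff coord_simps)

lemma lattice_polytope_hex_cross_polytope: "lattice_polytope (2 + n) (hex_cross_polytope n)"
  unfolding lattice_polytope_def hex_cross_polytope_eq_hull
proof (intro exI conjI)
  show "finite (hex_verts 1 \<union> shift 2 ` cross_verts n)"
    by (simp add: hex_verts_def cross_verts_def Let_def)
  show "hex_verts 1 \<union> shift 2 ` cross_verts n \<subseteq> Zn (2 + n)"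
    using hex_verts_Zn[of 1 n] unfolding shift_cross_verts
    by (auto simp: Zn_iff coord_simps)
qed (rule refl)

text \<open>The dual of a free sum is the product of the duals. The sign \<open>-1\<close> stems
  from the hexagon vertices \<open>e - f\<close> and \<open>- (e - f)\<close>.\<close>

definition hex_cube :: "nat \<Rightarrow> vec set" where
  "hex_cube n = {x \<in> Rn (2 + n). hex_norm (-1) x \<le> 1 \<and> (\<forall>i<n. \<bar>coord x (2 + i)\<bar> \<le> 1)}"

text \<open>Opposite generators give the two halves of an absolute-value bound, and the origin gives
  a vacuous condition.\<close>

lemma polar_dual_hex_cross_polytope: "polar_dual (2 + n) (hex_cross_polytope n) = hex_cube n"
proof -
  have p0: "pairing d x 0 = 0" for d x by (simp add: pairing_def)
  have ps: "pairing d x (s *\<^sub>R y) = s * pairing d x y" for d x s y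
    by (simp add: pairing_def coord_simps sum_distrib_left algebra_simps)
  show ?thesis
    unfolding hex_cross_polytope_eq_hull polar_dual_convex_hull hex_cube_def hex_verts_def Let_def
      shift_cross_verts hex_norm_le_iff
    by (rule Collect_cong) (auto simp: pairing_neg pairing_diff pairing_unit_vec p0 ps abs_le_iff ball_Un)
qed

lemma lattice_polytope_hex_cube: "lattice_polytope (2 + n) (hex_cube n)"
proof (induction n)
  case 0
  have "hex_cube 0 = convex hull (hex_verts (-1))"
    by (simp add: hex_cube_def hexagon_eq_hull)
  moreover have "finite (hex_verts (-1))" by (simp add: hex_verts_def Let_def)
  ultimately show ?case
    using hex_verts_Zn[of "-1" 0] unfolding lattice_polytope_def by auto
next
  case (Suc n)
  let ?e = "unit_vec (2 + n)"
  have "{x + t *\<^sub>R ?e | x t. x \<in> hex_cube n \<and> \<bar>t\<bar> \<le> 1} = hex_cube (Suc n)"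
  proof safe
    fix x and t :: real assume "x \<in> hex_cube n" "\<bar>t\<bar> \<le> 1"
    then show "x + t *\<^sub>R ?e \<in> hex_cube (Suc n)"
      unfolding hex_cube_def mem_Collect_eq hex_norm_add_unit_vec
      by (auto simp: Rn_iff coord_simps less_Suc_eq)
  next
    fix z assume z: "z \<in> hex_cube (Suc n)"
    define t where "t = coord z (2 + n)"
    define x where "x = z + (- t) *\<^sub>R ?e"
    have "x \<in> hex_cube n"
      using z unfolding x_def hex_cube_def mem_Collect_eq hex_norm_add_unit_vec
      by (auto simp: Rn_iff coord_simps t_def le_Suc_eq)
    moreover have "\<bar>t\<bar> \<le> 1"
      using z by (simp add: hex_cube_def t_def)
    moreover have "z = x + t *\<^sub>R ?e" by (simp add: x_def)
    ultimately show "\<exists>x t. z = x + t *\<^sub>R ?e \<and> x \<in> hex_cube n \<and> \<bar>t\<bar> \<le> 1" by blast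
  qed
  then show ?case
    using lattice_polytope_prism[OF Suc] by simp
qed

text \<open>The ambient norm is the sum of absolute coordinates. The bound places its unit ball
  inside the polytope, which makes 0 an interior point.\<close>

lemma hex_cross_norm_le_norm:
  assumes "x \<in> Rn (2 + n)"
  shows "hex_cross_norm n x \<le> norm x"
proof -
  have "norm x = (\<Sum>i\<in>Poly_Mapping.keys x. \<bar>coord x i\<bar>)"
    by (simp add: norm_poly_mapping_def dist_poly_mapping_def)
  also have "\<dots> = (\<Sum>i<2 + n. \<bar>coord x i\<bar>)"
    using assms by (intro sum.mono_neutral_left) (auto simp: Rn_def in_keys_iff)
  also have "\<dots> = \<bar>coord x 0\<bar> + \<bar>coord x 1\<bar> + (\<Sum>i<n. \<bar>coord x (2 + i)\<bar>)"
    by (induction n) (simp_all add: numeral_2_eq_2)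
  finally show ?thesis
    by (simp add: hex_cross_norm_def hex_norm_le_iff)
qed

lemma zero_interior_hex_cross_polytope:
  "0 \<in> (top_of_set (Rn (2 + n))) interior_of (hex_cross_polytope n)"
proof -
  let ?T = "Rn (2 + n) \<inter> ball 0 1"
  have "openin (top_of_set (Rn (2 + n))) ?T" by (simp add: openin_open_Int)
  moreover have "0 \<in> ?T" by (simp add: Rn_iff)
  moreover have "?T \<subseteq> hex_cross_polytope n"
    using hex_cross_norm_le_norm order_trans
    by (fastforce simp: hex_cross_polytope_def)
  ultimately show ?thesis
    unfolding interior_of_def by blast
qed

lemma reflexive_polytope_hex_cross_polytope: "reflexive_polytope (2 + n) (hex_cross_polytope n)"
  unfolding reflexive_polytope_def polar_dual_hex_cross_polytope
  using lattice_polytope_hex_cross_polytope lattice_polytope_hex_cube zero_interior_hex_cross_polytope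
  by blast

subsection \<open>Lattice points\<close>

text \<open>The lattice points of the \<open>k\<close>-th dilate, described without scaling so that
  slices are again of this form.\<close>

definition lattice_ball :: "nat \<Rightarrow> nat \<Rightarrow> vec set" where
  "lattice_ball n k = {x \<in> Zn (2 + n). hex_cross_norm n x \<le> real k}"

lemma dilate_Int_Zn:
  "(\<lambda>x. real k *\<^sub>R x) ` hex_cross_polytope n \<inter> Zn (2 + n) = lattice_ball n k"
proof (intro subset_antisym subsetI)
  fix x assume "x \<in> (\<lambda>x. real k *\<^sub>R x) ` hex_cross_polytope n \<inter> Zn (2 + n)"
  then obtain y where y: "x = real k *\<^sub>R y" "hex_cross_norm n y \<le> 1" and x: "x \<in> Zn (2 + n)"
    by (auto simp: hex_cross_polytope_def)
  then have "hex_cross_norm n x \<le> real k"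
    using mult_left_mono[OF y(2), of "real k"] by (simp add: norm_on_scaleR[OF norm_on_hex_cross_norm])
  with x show "x \<in> lattice_ball n k" by (simp add: lattice_ball_def)
next
  fix x assume "x \<in> lattice_ball n k"
  then have x: "x \<in> Zn (2 + n)" "x \<in> Rn (2 + n)" "hex_cross_norm n x \<le> real k"
    by (simp_all add: lattice_ball_def Zn_def)
  have "x \<in> (\<lambda>x. real k *\<^sub>R x) ` hex_cross_polytope n"
  \<comment> \<open>The 0-th dilate is the origin alone, which definiteness of the norm recovers;
    otherwise divide by \<open>k\<close>.\<close>
  proof (cases "k = 0")
    case True
    then have "hex_cross_norm n x = 0"
      using x(3) norm_on_nonneg[OF norm_on_hex_cross_norm, of n x] by simp
    then have "x = 0" using norm_on_eq_0[OF norm_on_hex_cross_norm] x(2) by blast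
    moreover have "0 \<in> hex_cross_polytope n"
      by (simp add: hex_cross_polytope_def Rn_iff norm_on_0[OF norm_on_hex_cross_norm])
    ultimately show ?thesis using True by (intro image_eqI[of _ _ 0]) auto
  next
    case False
    with x have "inverse (real k) *\<^sub>R x \<in> hex_cross_polytope n"
      by (simp add: hex_cross_polytope_def subspace_Rn subspace_scale field_simps
          norm_on_scaleR[OF norm_on_hex_cross_norm])
    with False show ?thesis by (intro image_eqI[of _ _ "inverse (real k) *\<^sub>R x"]) auto
  qed
  with x show "x \<in> (\<lambda>x. real k *\<^sub>R x) ` hex_cross_polytope n \<inter> Zn (2 + n)" by simp
qed

text \<open>Reflecting \<open>j\<close> to \<open>- j\<close> pairs the terms other than
  \<open>j = 0\<close>. This turns sums over slices into the form of
  \<open>poly_hex_cross_poly_Suc\<close>.\<close>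

lemma sum_symmetric_interval:
  fixes f :: "nat \<Rightarrow> 'a :: comm_semiring_1"
  shows "(\<Sum>j = - int k..int k. f (nat (int k - \<bar>j\<bar>))) = f k + 2 * (\<Sum>i<k. f i)"
proof -
  let ?g = "\<lambda>j. f (nat (int k - \<bar>j\<bar>))"
  have eq: "{- int k..int k} = insert 0 ({- int k..-1} \<union> {1..int k})" by auto
  have "(\<Sum>j = - int k..int k. ?g j) = f k + (sum ?g {- int k..-1} + sum ?g {1..int k})"
    unfolding eq by (subst sum.insert) (auto simp: sum.union_disjoint)
  also have "sum ?g {- int k..-1} = (\<Sum>i<k. f i)"
    by (rule sum.reindex_bij_witness[of _ "\<lambda>i. int i - int k" "\<lambda>j. nat (int k + j)"]) auto
  also have "sum ?g {1..int k} = (\<Sum>i<k. f i)"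
    by (rule sum.reindex_bij_witness[of _ "\<lambda>i. int k - int i" "\<lambda>j. nat (int k - j)"]) auto
  finally show ?thesis by (simp add: mult_2)
qed

lemma lattice_ball_0:
  "finite (lattice_ball 0 k)" "card (lattice_ball 0 k) = 3 * k\<^sup>2 + 3 * k + 1"
proof -
  \<comment> \<open>\<open>B a\<close> is the interval of second coordinates allowed when the first
    one is \<open>a\<close>.\<close>
  define B where "B = (\<lambda>a. {max (- int k) (- int k - a)..min (int k) (int k - a)})"
  define S where "S = (SIGMA a:{- int k..int k}. B a)"
  define h :: "int \<times> int \<Rightarrow> vec"
    where "h = (\<lambda>(a, b). of_int a *\<^sub>R unit_vec 0 + of_int b *\<^sub>R unit_vec 1)"
  have h: "coord (h (a, b)) i = (if i = 0 then of_int a else if i = 1 then of_int b else 0)" for a b i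
    by (simp add: h_def coord_simps)
  have mem: "(a, b) \<in> S \<longleftrightarrow> \<bar>real_of_int a\<bar> \<le> real k \<and> \<bar>real_of_int b\<bar> \<le> real k
      \<and> \<bar>real_of_int a + real_of_int b\<bar> \<le> real k" for a b
  proof -
    have "(a, b) \<in> S \<longleftrightarrow> \<bar>a\<bar> \<le> int k \<and> \<bar>b\<bar> \<le> int k \<and> \<bar>a + b\<bar> \<le> int k"
      by (auto simp: S_def B_def)
    then show ?thesis by linarith
  qed
  have inj: "inj_on h S"
  proof (rule inj_onI)
    fix p q assume "h p = h q"
    then have "coord (h p) 0 = coord (h q) 0" "coord (h p) 1 = coord (h q) 1" by simp_all
    then show "p = q" by (cases p, cases q) (simp add: h)
  qed
  have img: "lattice_ball 0 k = h ` S"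
  proof (intro subset_antisym subsetI)
    fix x assume x: "x \<in> lattice_ball 0 k"
    then obtain a b where ab: "coord x 0 = of_int a" "coord x 1 = of_int b"
      by (auto simp: lattice_ball_def Zn_iff elim!: Ints_cases) (metis Ints_cases)
    have "x = h (a, b)"
      using x ab by (intro poly_mapping_eqI) (auto simp: h lattice_ball_def Zn_iff)
    moreover have "(a, b) \<in> S"
      using x ab by (simp add: mem lattice_ball_def hex_cross_norm_def hex_norm_le_iff)
    ultimately show "x \<in> h ` S" by blast
  next
    fix x assume "x \<in> h ` S"
    then obtain a b where "x = h (a, b)" "(a, b) \<in> S" by auto
    then show "x \<in> lattice_ball 0 k"
      by (simp add: mem lattice_ball_def hex_cross_norm_def hex_norm_le_iff h Zn_iff)
  qed
  have fin: "finite S" by (simp add: S_def B_def)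
  then show "finite (lattice_ball 0 k)" by (simp add: img)
  have "card S = (\<Sum>a = - int k..int k. card (B a))"
    unfolding S_def by (rule card_SigmaI) (auto simp: B_def)
  \<comment> \<open>The row has \<open>2 * k + 1 - \<bar>a\<bar>\<close> points, written as a
    function of \<open>int k - \<bar>a\<bar>\<close> to fit
    \<open>sum_symmetric_interval\<close>.\<close>
  also have "\<dots> = (\<Sum>a = - int k..int k. k + 1 + nat (int k - \<bar>a\<bar>))"
    by (intro sum.cong refl) (auto simp: B_def)
  also have "\<dots> = (k + 1 + k) + 2 * (\<Sum>i<k. k + 1 + i)"
    by (rule sum_symmetric_interval)
  \<comment> \<open>Doubling and adding \<open>k\<close> avoids division and subtraction of natural
    numbers.\<close>
  also have "2 * (\<Sum>i<k. m + i) + k = 2 * k * m + k * k" for m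
    by (induction k) (simp_all add: algebra_simps)
  then have "2 * (\<Sum>i<k. k + 1 + i) + k = 2 * k * (k + 1) + k * k" .
  then have "(k + 1 + k) + 2 * (\<Sum>i<k. k + 1 + i) = 3 * k\<^sup>2 + 3 * k + 1"
    by (simp add: algebra_simps power2_eq_square)
  finally show "card (lattice_ball 0 k) = 3 * k\<^sup>2 + 3 * k + 1"
    by (simp add: img card_image[OF inj])
qed

text \<open>Slicing by the last coordinate: height \<open>j\<close> uses up
  \<open>\<bar>j\<bar>\<close> of the radius and leaves a ball one dimension lower.\<close>

lemma lattice_ball_Suc:
  "lattice_ball (Suc n) k = (\<Union>j\<in>{- int k..int k}.
     (\<lambda>x. x + of_int j *\<^sub>R unit_vec (2 + n)) ` lattice_ball n (nat (int k - \<bar>j\<bar>)))"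
proof -
  let ?e = "unit_vec (2 + n)"
  have norm_eq: "hex_cross_norm (Suc n) (x + t *\<^sub>R ?e) = hex_cross_norm n x + \<bar>t\<bar>"
    if "x \<in> Zn (2 + n)" for x t
    using that unfolding hex_cross_norm_def hex_norm_add_unit_vec by (simp add: coord_simps Zn_iff)
  show ?thesis
  proof (intro subset_antisym subsetI)
    fix z assume z: "z \<in> lattice_ball (Suc n) k"
    then obtain j where j: "coord z (2 + n) = of_int j"
      by (auto simp: lattice_ball_def Zn_iff) (metis Ints_cases)
    define x where "x = z + (- of_int j) *\<^sub>R ?e"
    have zx: "z = x + of_int j *\<^sub>R ?e" by (simp add: x_def)
    have x: "x \<in> Zn (2 + n)"
      unfolding Zn_iff
    proof (intro conjI allI impI)
      fix i
      have "coord z i = 0" if "i > 2 + n"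
        using z that by (simp add: lattice_ball_def Zn_iff)
      then show "coord x i = 0" if "2 + n \<le> i"
        using that j by (cases "i = 2 + n") (simp_all add: x_def coord_simps)
      show "coord x i \<in> \<int>"
        using z by (simp add: x_def coord_simps lattice_ball_def Zn_iff)
    qed
    have le: "hex_cross_norm n x + \<bar>real_of_int j\<bar> \<le> real k"
      using z norm_eq[OF x, of "of_int j"] by (simp add: lattice_ball_def zx)
    then have "\<bar>real_of_int j\<bar> \<le> real k"
      using norm_on_nonneg[OF norm_on_hex_cross_norm, of n x] by linarith
    \<comment> \<open>This makes \<open>nat (int k - \<bar>j\<bar>)\<close> an untruncated
      difference.\<close>
    then have jk: "\<bar>j\<bar> \<le> int k" by linarith
    then have "x \<in> lattice_ball n (nat (int k - \<bar>j\<bar>))"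
      using le x by (simp add: lattice_ball_def)
    with jk zx show "z \<in> (\<Union>j\<in>{- int k..int k}.
        (\<lambda>x. x + of_int j *\<^sub>R ?e) ` lattice_ball n (nat (int k - \<bar>j\<bar>)))"
      by (intro UN_I[of j]) auto
  next
    fix z assume "z \<in> (\<Union>j\<in>{- int k..int k}.
        (\<lambda>x. x + of_int j *\<^sub>R ?e) ` lattice_ball n (nat (int k - \<bar>j\<bar>)))"
    then obtain j x where j: "j \<in> {- int k..int k}" and z: "z = x + of_int j *\<^sub>R ?e"
      and x: "x \<in> lattice_ball n (nat (int k - \<bar>j\<bar>))"
      by blast
    have jk: "\<bar>j\<bar> \<le> int k" using j by auto
    have xZ: "x \<in> Zn (2 + n)" using x by (simp add: lattice_ball_def)
    have "hex_cross_norm (Suc n) z \<le> real k"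
      using x jk norm_eq[OF xZ] by (simp add: z lattice_ball_def)
    moreover have "z \<in> Zn (2 + Suc n)"
      using xZ by (auto simp: z Zn_iff coord_simps)
    ultimately show "z \<in> lattice_ball (Suc n) k" by (simp add: lattice_ball_def)
  qed
qed

text \<open>Slices at different heights are disjoint, as the last coordinate recovers
  \<open>j\<close>, so the counts obey the recursion of \<open>hex_cross_poly\<close>. Finiteness is
  carried along for the cardinality of the union.\<close>

lemma card_lattice_ball:
  "finite (lattice_ball n k) \<and> of_nat (card (lattice_ball n k)) = poly (hex_cross_poly n) (of_nat k)"
proof (induction n arbitrary: k)
  case 0
  show ?case by (simp add: lattice_ball_0 poly_hex_cross_poly_base)
next
  case (Suc n)
  let ?e = "unit_vec (2 + n)"
  let ?F = "\<lambda>j. (\<lambda>x. x + of_int j *\<^sub>R ?e) ` lattice_ball n (nat (int k - \<bar>j\<bar>))"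
  have fin: "finite (?F j)" for j using Suc by simp
  have top: "coord z (2 + n) = of_int j" if "z \<in> ?F j" for z j
    using that by (auto simp: lattice_ball_def Zn_iff coord_simps)
  have "card (lattice_ball (Suc n) k) = (\<Sum>j = - int k..int k. card (?F j))"
    unfolding lattice_ball_Suc
  proof (rule card_UN_disjoint)
    show "\<forall>i\<in>{- int k..int k}. \<forall>j\<in>{- int k..int k}. i \<noteq> j \<longrightarrow> ?F i \<inter> ?F j = {}"
      using top by (metis disjoint_iff of_int_eq_iff)
  qed (use fin in auto)
  also have "\<dots> = (\<Sum>j = - int k..int k. card (lattice_ball n (nat (int k - \<bar>j\<bar>))))"
    by (intro sum.cong refl card_image) (auto simp: inj_on_def)
  also have "\<dots> = card (lattice_ball n k) + 2 * (\<Sum>i<k. card (lattice_ball n i))"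
    using sum_symmetric_interval[of "\<lambda>i. card (lattice_ball n i)" k] by simp
  finally have "of_nat (card (lattice_ball (Suc n) k)) = poly (hex_cross_poly (Suc n)) (of_nat k)"
    using Suc by (simp add: poly_hex_cross_poly_Suc)
  moreover have "finite (lattice_ball (Suc n) k)"
    unfolding lattice_ball_Suc using fin by blast
  ultimately show ?case by blast
qed

theorem theorem2:
  fixes n :: nat
  shows "CL_polytope (2 + n)
    (free_sum 2 (polar_dual 2 (root_polytope_A 2))
      (free_sum_power 1 (polar_dual 1 (root_polytope_A 1)) n))"
proof -
  have "is_ehrhart_polynomial (2 + n) (hex_cross_polytope n) (hex_cross_poly n)"
    unfolding is_ehrhart_polynomial_def dilate_Int_Zn using card_lattice_ball by simp
  then show ?thesis
    unfolding CL_polytope_def hex_cross_polytope_eq_free_sum[symmetric]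
    using reflexive_polytope_hex_cross_polytope hex_cross_poly_roots by blast
qed

end
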